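(* Let $n\geq 1$ and $0\leq i,j\leq n-1$ be integers, and set $$L=\left[\frac{n-1-i}{q}\right]+\left[\frac{n-1-j}{p}\right]+1,$$ where $[\cdot]$ denotes the integer part. If $0\leq\ell\leq L$, then $$\mathcal{D}_{[\ell,i,j,n]}=\mathcal{D}_{[\ell,i,j]}\qquad\text{and}\qquad A_{[\ell,i,j,n]}=A_{[\ell,i,j]}.$$ Moreover, $$A_{i,j}(z)-R_{i,j,n}(z)=O(z^{-L-2}),\qquad z\rightarrow\infty,$$ that is, in the formal Laurent series $A_{i,j}(z)-R_{i,j,n}(z)$ all coefficients of $z^{m}$ with $m>-L-2$ vanish.
   Context: Fix integers $p,q\geq 1$ and, for each $-p\leq k\leq q$, a bi-infinite sequence $(a^{(k)}_{n})_{n\in\mathbb{Z}}$ of complex numbers. A step is an ordered pair $(n,m)\rightarrow(n+1,m')$ with $n\in\mathbb{Z}_{\geq 0}$, $m,m'\in\mathbb{Z}$ and $-p\leq m'-m\leq q$. Its weight is $a_m^{(i)}$ if $m'=m+i$ with $0\leq i\leq q$, and $a_{m-j}^{(-j)}$ if $m'=m-j$ with $1\leq j\leq p$. A lattice path of length $k$ is a sequence of $k$ steps in which the final vertex of each step is the initial vertex of the next; a path of length zero is a single vertex. The weight $w(\gamma)$ of a path is the product of the weights of its steps ($1$ for length zero). Empty sums are zero. For $\ell,i,j\geq 0$, $\mathcal{D}_{[\ell,i,j]}$ is the collection of all lattice paths of length $\ell$ from $(0,i)$ to $(\ell,j)$ with no point below the $x$-axis. For $n\geq 1$, $0\leq i,j\leq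 n-1$, $\mathcal{D}_{[\ell,i,j,n]}$ is the collection of all lattice paths of length $\ell$ from $(0,i)$ to $(\ell,j)$ with no vertex below the $x$-axis or above the line $y=n-1$. Put $A_{[\ell,i,j]}=\sum_{\gamma\in\mathcal{D}_{[\ell,i,j]}}w(\gamma)$, $A_{[\ell,i,j,n]}=\sum_{\gamma\in\mathcal{D}_{[\ell,i,j,n]}}w(\gamma)$, and $A_{i,j}(z)=\sum_{\ell=0}^{\infty}A_{[\ell,i,j]}z^{-\ell-1}$ (a formal Laurent series). Let $H_n=(h_{i,j})_{i,j=0}^{n-1}$ be the $n\times n$ matrix with $h_{i,j}=a^{(j-i)}_{\min(i,j)}$ if $-p\leq j-i\leq q$ and $h_{i,j}=0$ otherwise. For $0\leq i,j\leq n-1$, $$R_{i,j,n}(z)=\langle(zI_n-H_n)^{-1}e_j,e_i\rangle=\sum_{\ell=0}^{\infty}\frac{(H_n^{\ell})_{i,j}}{z^{\ell+1}},$$ a rational function identified with its Laurent expansion at infinity; $\{e_i\}_{i=0}^{n-1}$ is the standard basis of $\mathbb{C}^n$. *)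

theory Defs
  imports
    "HOL-Computational_Algebra.Formal_Laurent_Series"
    "Jordan_Normal_Form.Determinant"
begin

section \<open>Lattice paths\<close>

type_synonym vertex = "nat \<times> int"

definition is_step :: "nat \<Rightarrow> nat \<Rightarrow> vertex \<Rightarrow> vertex \<Rightarrow> bool" where
  "is_step p q v v' \<longleftrightarrow>
     fst v' = fst v + 1 \<and> - int p \<le> snd v' - snd v \<and> snd v' - snd v \<le> int q"

text \<open>The sequence \<open>a^(k)\<close>, \<open>-p \<le> k \<le> q\<close>, is \<open>a k\<close>; the values \<open>a k\<close> for \<open>k\<close> outside this range
  never enter. A descending step ending at height \<open>m' = m - j\<close> has weight
  \<open>a^(-j)\<close> taken at index \<open>m - j = m'\<close>.\<close>

definition step_weight :: "(int \<Rightarrow> int \<Rightarrow> complex) \<Rightarrow> vertex \<Rightarrow> vertex \<Rightarrow> complex" where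
  "step_weight a v v' =
     (if snd v \<le> snd v' then a (snd v' - snd v) (snd v) else a (snd v' - snd v) (snd v'))"

text \<open>A path with \<open>k\<close> steps is represented by the list of its \<open>k + 1\<close> successive vertices,
  so that a path of length zero is a singleton list.\<close>

definition lattice_path :: "nat \<Rightarrow> nat \<Rightarrow> nat \<Rightarrow> vertex list \<Rightarrow> bool" where
  "lattice_path p q k \<gamma> \<longleftrightarrow>
     length \<gamma> = k + 1 \<and> (\<forall>r<k. is_step p q (\<gamma> ! r) (\<gamma> ! (r + 1)))"

definition path_weight :: "(int \<Rightarrow> int \<Rightarrow> complex) \<Rightarrow> vertex list \<Rightarrow> complex" where
  "path_weight a \<gamma> = (\<Prod>r<length \<gamma> - 1. step_weight a (\<gamma> ! r) (\<gamma> ! (r + 1)))"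

text \<open>The segments of a path lie above the \<open>x\<close>-axis iff its vertices do, so it suffices
  to constrain the vertices.\<close>

definition paths :: "nat \<Rightarrow> nat \<Rightarrow> nat \<Rightarrow> nat \<Rightarrow> nat \<Rightarrow> vertex list set" where
  "paths p q l i j =
     {\<gamma>. lattice_path p q l \<gamma> \<and> hd \<gamma> = (0, int i) \<and> last \<gamma> = (l, int j) \<and>
         (\<forall>v\<in>set \<gamma>. 0 \<le> snd v)}"

definition bounded_paths :: "nat \<Rightarrow> nat \<Rightarrow> nat \<Rightarrow> nat \<Rightarrow> nat \<Rightarrow> nat \<Rightarrow> vertex list set" where
  "bounded_paths p q l i j n =
     {\<gamma>. lattice_path p q l \<gamma> \<and> hd \<gamma> = (0, int i) \<and> last \<gamma> = (l, int j) \<and>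
         (\<forall>v\<in>set \<gamma>. 0 \<le> snd v \<and> snd v \<le> int n - 1)}"

definition path_sum ::
  "nat \<Rightarrow> nat \<Rightarrow> (int \<Rightarrow> int \<Rightarrow> complex) \<Rightarrow> nat \<Rightarrow> nat \<Rightarrow> nat \<Rightarrow> complex" where
  "path_sum p q a l i j = (\<Sum>\<gamma>\<in>paths p q l i j. path_weight a \<gamma>)"

definition bounded_path_sum ::
  "nat \<Rightarrow> nat \<Rightarrow> (int \<Rightarrow> int \<Rightarrow> complex) \<Rightarrow> nat \<Rightarrow> nat \<Rightarrow> nat \<Rightarrow> nat \<Rightarrow> complex" where
  "bounded_path_sum p q a l i j n = (\<Sum>\<gamma>\<in>bounded_paths p q l i j n. path_weight a \<gamma>)"

text \<open>The path sets are finite, so the sums above are genuine.\<close>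

lemma finite_paths: "finite (paths p q l i j)"
proof -
  have bound: "\<gamma> ! r \<in> {0..l} \<times> {0..int i + int l * int q}"
    if g: "\<gamma> \<in> paths p q l i j" and r: "r \<le> l" for \<gamma> r
  proof -
    have path: "length \<gamma> = l + 1" "\<forall>r<l. is_step p q (\<gamma> ! r) (\<gamma> ! (r + 1))"
      and hd: "hd \<gamma> = (0, int i)" and nonneg: "\<forall>v\<in>set \<gamma>. 0 \<le> snd v"
      using g by (auto simp: paths_def lattice_path_def)
    have z: "\<gamma> ! 0 = (0, int i)"
      using path(1) hd by (cases \<gamma>) auto
    have *: "r \<le> l \<Longrightarrow> fst (\<gamma> ! r) = r \<and> snd (\<gamma> ! r) \<le> int i + int r * int q"
    proof (induction r)
      case (Suc r)
      then have "is_step p q (\<gamma> ! r) (\<gamma> ! Suc r)" using path(2) by simp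
      then show ?case using Suc by (auto simp: is_step_def algebra_simps)
    qed (simp add: z)
    have "int r * int q \<le> int l * int q"
      using r by (simp add: mult_right_mono)
    moreover have "0 \<le> snd (\<gamma> ! r)"
      using nonneg path(1) r by simp
    ultimately show ?thesis
      using *[OF r] r by (cases "\<gamma> ! r") auto
  qed
  let ?B = "{0..l} \<times> {0..int i + int l * int q}"
  have "paths p q l i j \<subseteq> {xs. set xs \<subseteq> ?B \<and> length xs = l + 1}"
  proof
    fix \<gamma> assume g: "\<gamma> \<in> paths p q l i j"
    then have len: "length \<gamma> = l + 1" by (simp add: paths_def lattice_path_def)
    have "x \<in> ?B" if "x \<in> set \<gamma>" for x
      using that len bound[OF g] unfolding in_set_conv_nth by (metis Suc_eq_plus1 less_Suc_eq_le)
    then show "\<gamma> \<in> {xs. set xs \<subseteq> ?B \<and> length xs = l + 1}" using len by blast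
  qed
  moreover have "finite {xs. set xs \<subseteq> ?B \<and> length xs = l + 1}"
    by (rule finite_lists_length_eq) simp
  ultimately show ?thesis by (rule finite_subset)
qed

lemma finite_bounded_paths: "finite (bounded_paths p q l i j n)"
  by (rule finite_subset[OF _ finite_paths[of p q l i j]])
     (auto simp: bounded_paths_def paths_def)


section \<open>Formal Laurent series in \<open>1/z\<close>\<close>

text \<open>\<open>complex fls\<close> is used as the field of formal Laurent series in \<open>1/z\<close>: its variable
  \<open>fls_X\<close> is \<open>1/z\<close>, so \<open>z = fls_X_inv\<close> and exponents of \<open>z\<close> are negated.\<close>

abbreviation z_var :: "complex fls" where
  "z_var \<equiv> fls_X_inv"

definition z_coeff :: "complex fls \<Rightarrow> int \<Rightarrow> complex" where
  "z_coeff F m = fls_nth F (- m)"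

definition path_series ::
  "nat \<Rightarrow> nat \<Rightarrow> (int \<Rightarrow> int \<Rightarrow> complex) \<Rightarrow> nat \<Rightarrow> nat \<Rightarrow> complex fls" where
  "path_series p q a i j = fps_to_fls (fps_X * Abs_fps (\<lambda>l. path_sum p q a l i j))"

lemma z_coeff_path_series:
  "z_coeff (path_series p q a i j) m =
     (if m \<le> - 1 then path_sum p q a (nat (- m - 1)) i j else 0)"
  by (auto simp: z_coeff_def path_series_def nat_diff_distrib)


section \<open>The truncated matrix and its resolvent\<close>

definition H_mat :: "nat \<Rightarrow> nat \<Rightarrow> (int \<Rightarrow> int \<Rightarrow> complex) \<Rightarrow> nat \<Rightarrow> complex mat" where
  "H_mat p q a n =
     mat n n (\<lambda>(i, j).
       if - int p \<le> int j - int i \<and> int j - int i \<le> int q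
       then a (int j - int i) (int (min i j)) else 0)"

text \<open>\<open>z I - H\<close>, over the field of Laurent series in \<open>1/z\<close>. This field contains the rational
  functions of \<open>z\<close> (by expansion at infinity), so inverting here yields the
  expansion at infinity of the rational resolvent.\<close>

definition zI_minus :: "complex mat \<Rightarrow> complex fls mat" where
  "zI_minus H = z_var \<cdot>\<^sub>m 1\<^sub>m (dim_row H) - map_mat fls_const H"

text \<open>No conjugation is needed in the inner product, since \<open>e_i\<close> is real.\<close>

definition resolvent ::
  "nat \<Rightarrow> nat \<Rightarrow> (int \<Rightarrow> int \<Rightarrow> complex) \<Rightarrow> nat \<Rightarrow> nat \<Rightarrow> nat \<Rightarrow> complex fls" where
  "resolvent p q a i j n =
     (the (mat_inverse (zI_minus (H_mat p q a n))) *\<^sub>v unit_vec n j) \<bullet> unit_vec n i"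

text \<open>The inverse exists and is given by the Neumann series.\<close>

lemma mat_inverse_zI_minus:
  assumes H: "H \<in> carrier_mat n n"
  shows "mat_inverse (zI_minus H) =
    Some (mat n n (\<lambda>(i, j). fps_to_fls (fps_X * Abs_fps (\<lambda>l. (H ^\<^sub>m l) $$ (i, j)))))"
    (is "_ = Some ?N")
proof -
  let ?M = "zI_minus H"
  have M: "?M \<in> carrier_mat n n" and N: "?N \<in> carrier_mat n n"
    using H by (auto simp: zI_minus_def)
  have NM: "?N * ?M = 1\<^sub>m n"
  proof (rule eq_matI)
    fix i j assume "i < dim_row (1\<^sub>m n :: complex fls mat)" "j < dim_col (1\<^sub>m n :: complex fls mat)"
    then have ij: "i < n" "j < n" by auto
    define f where "f k = fps_to_fls (fps_X * Abs_fps (\<lambda>l. (H ^\<^sub>m l) $$ (i, k)))" for k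
    have f_nth: "fls_nth (f k) m = (if 1 \<le> m then (H ^\<^sub>m nat (m - 1)) $$ (i, k) else 0)" for k m
      by (auto simp: f_def nat_diff_distrib)
    have Mkj: "?M $$ (k, j) = (if k = j then z_var else 0) - fls_const (H $$ (k, j))"
      if "k < n" for k
      using that ij H by (auto simp: zI_minus_def)
    have "(?N * ?M) $$ (i, j) = (\<Sum>k<n. f k * ?M $$ (k, j))"
      using ij M by (simp add: scalar_prod_def f_def atLeast0LessThan)
    also have "\<dots> = (\<Sum>k<n. (if k = j then f k * z_var else 0) - f k * fls_const (H $$ (k, j)))"
      by (intro sum.cong refl) (auto simp: Mkj algebra_simps)
    also have "\<dots> = f j * z_var - (\<Sum>k<n. f k * fls_const (H $$ (k, j)))"
      using ij by (simp add: sum_subtractf)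
    also have "\<dots> = (1\<^sub>m n) $$ (i, j)"
    proof (rule fls_eqI)
      fix m :: int
      have lhs: "fls_nth (f j * z_var - (\<Sum>k<n. f k * fls_const (H $$ (k, j)))) m =
        fls_nth (f j) (m + 1) - (\<Sum>k<n. fls_nth (f k) m * H $$ (k, j))"
        by (simp add: fls_X_inv_times_conv_shift fls_nth_sum)
      consider "m < 0" | "m = 0" | l where "m = int l + 1"
      proof (cases "m \<le> 0")
        case False
        then have "m = int (nat (m - 1)) + 1" by simp
        then show ?thesis by (rule that(3))
      qed (use that in force)
      then show "fls_nth (f j * z_var - (\<Sum>k<n. f k * fls_const (H $$ (k, j)))) m =
          fls_nth ((1\<^sub>m n) $$ (i, j)) m"
      proof cases
        case 3
        have "(H ^\<^sub>m Suc l) $$ (i, j) = (\<Sum>k<n. (H ^\<^sub>m l) $$ (i, k) * H $$ (k, j))"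
          using ij H pow_carrier_mat[OF H, of l] by (simp add: scalar_prod_def atLeast0LessThan)
        moreover have "nat (1 + int l) = Suc l" by simp
        ultimately show ?thesis using 3 ij unfolding lhs by (simp add: f_nth)
      qed (unfold lhs, use ij H in \<open>auto simp: f_nth\<close>)
    qed
    finally show "(?N * ?M) $$ (i, j) = (1\<^sub>m n) $$ (i, j)" .
  qed (use M N in auto)
  have MN: "?M * ?N = 1\<^sub>m n"
    by (rule mat_mult_left_right_inverse[OF N M NM])
  have "?M \<in> Units (ring_mat TYPE(complex fls) n ())"
    unfolding Units_def ring_mat_def using M N NM MN
    by (auto intro!: bexI[OF _ N])
  then obtain B where B: "mat_inverse ?M = Some B"
    using mat_inverse(1)[OF M, of "()"] by (cases "mat_inverse ?M") blast+
  have MB: "?M * B = 1\<^sub>m n" and Bc: "B \<in> carrier_mat n n"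
    using mat_inverse(2)[OF M B] by auto
  have "B = (?N * ?M) * B" unfolding NM using Bc by (rule left_mult_one_mat[symmetric])
  also have "\<dots> = ?N * (?M * B)" by (rule assoc_mult_mat[OF N M Bc])
  also have "\<dots> = ?N" unfolding MB using N by (rule right_mult_one_mat)
  finally have "B = ?N" .
  with B show ?thesis by (rule trans[OF _ arg_cong])
qed

lemma z_coeff_resolvent:
  assumes "i < n" "j < n"
  shows "z_coeff (resolvent p q a i j n) m =
    (if m \<le> - 1 then (H_mat p q a n ^\<^sub>m nat (- m - 1)) $$ (i, j) else 0)"
proof -
  have H: "H_mat p q a n \<in> carrier_mat n n" by (simp add: H_mat_def)
  show ?thesis
    using assms unfolding resolvent_def mat_inverse_zI_minus[OF H]
    by (auto simp: z_coeff_def nat_diff_distrib)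
qed

end

theory Submission
  imports Defs
begin

text \<open>A path leaving the strip reaches a height \<open>\<ge> n\<close> after some \<open>r\<close> steps. Climbing there from
  \<open>i\<close> forces \<open>r > (n - 1 - i) div q\<close>, and descending to \<open>j\<close> in the remaining \<open>l - r\<close> steps forces
  \<open>l - r > (n - 1 - j) div p\<close>, so that \<open>l > L\<close>. Splitting off the last step shows that the
  entries of \<open>H ^ l\<close> are the weighted sums over paths in the strip, so the coefficients of
  both series agree up to \<open>l = L\<close>.\<close>

text \<open>Paths grow at the right end, because the matrix power satisfies
  \<open>H ^\<^sub>m Suc l = H ^\<^sub>m l * H\<close>. If the length of \<gamma> is not
  \<open>Suc l\<close>, both sides are false.\<close>

lemma lattice_path_snoc:
  "lattice_path p q (Suc l) (\<gamma> @ [v]) \<longleftrightarrow> lattice_path p q l \<gamma> \<and> is_step p q (last \<gamma>) v"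
proof (cases "length \<gamma> = Suc l")
  case True
  then have "last \<gamma> = \<gamma> ! l" by (cases \<gamma> rule: rev_cases) (auto simp: nth_append)
  then show ?thesis using True
    by (simp add: lattice_path_def nth_append All_less_Suc conj_commute)
qed (simp add: lattice_path_def)

lemma path_weight_snoc:
  assumes "\<gamma> \<noteq> []"
  shows "path_weight a (\<gamma> @ [v]) = path_weight a \<gamma> * step_weight a (last \<gamma>) v"
proof -
  obtain k where k: "length \<gamma> = Suc k" using assms by (cases \<gamma>) auto
  then have "last \<gamma> = \<gamma> ! k" by (cases \<gamma> rule: rev_cases) (auto simp: nth_append)
  then show ?thesis using k by (simp add: path_weight_def nth_append)
qed


text \<open>Each step rises by at most q and falls by at most p. The first bound limits the climb
  from the starting point, the second the descent to the end point.\<close>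

lemma lattice_path_height_le:
  assumes "lattice_path p q l \<gamma>" "r + s \<le> l"
  shows "snd (\<gamma> ! (r + s)) \<le> snd (\<gamma> ! r) + int s * int q"
    and "snd (\<gamma> ! r) \<le> snd (\<gamma> ! (r + s)) + int s * int p"
  using assms(2)
proof (induction s)
  case (Suc s)
  {
    case 1
    then have "is_step p q (\<gamma> ! (r + s)) (\<gamma> ! Suc (r + s))"
      using assms(1) by (simp add: lattice_path_def)
    with Suc 1 show ?case by (simp add: is_step_def algebra_simps)
  next
    case 2
    then have "is_step p q (\<gamma> ! (r + s)) (\<gamma> ! Suc (r + s))"
      using assms(1) by (simp add: lattice_path_def)
    with Suc 2 show ?case by (simp add: is_step_def algebra_simps)
  }
qed simp_all

lemma bounded_paths_0:
  assumes "i < n"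
  shows "bounded_paths p q 0 i j n = (if i = j then {[(0, int i)]} else {})"
  using assms by (auto simp: bounded_paths_def lattice_path_def length_Suc_conv)

text \<open>Deleting the last vertex leaves a path in the strip that ends at some height k, from
  which a single step leads to j.\<close>

lemma bounded_paths_Suc:
  assumes "j < n"
  shows "bounded_paths p q (Suc l) i j n =
    (\<Union>k\<in>{k. k < n \<and> - int p \<le> int j - int k \<and> int j - int k \<le> int q}.
       (\<lambda>\<gamma>. \<gamma> @ [(Suc l, int j)]) ` bounded_paths p q l i k n)"
    (is "?A = ?B")
proof (intro subset_antisym subsetI)
  fix \<gamma> assume g: "\<gamma> \<in> ?A"
  then have "length \<gamma> = Suc (Suc l)" by (simp add: bounded_paths_def lattice_path_def)
  then obtain \<delta> v where \<gamma>: "\<gamma> = \<delta> @ [v]" and len: "length \<delta> = Suc l"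
    by (cases \<gamma> rule: rev_cases) auto
  have v: "v = (Suc l, int j)" and path: "lattice_path p q l \<delta>"
    and step: "is_step p q (last \<delta>) v"
    using g by (auto simp: \<gamma> bounded_paths_def lattice_path_snoc)
  have ne: "\<delta> \<noteq> []" using len by auto
  then have hd: "hd \<delta> = (0, int i)" and last: "last \<delta> \<in> set \<delta>"
    and strip: "\<forall>v\<in>set \<delta>. 0 \<le> snd v \<and> snd v \<le> int n - 1"
    using g by (simp_all add: \<gamma> bounded_paths_def)
  \<comment> \<open>Heights in the strip are nonnegative, so \<open>nat\<close> loses nothing
    here.\<close>
  define k where "k = nat (snd (last \<delta>))"
  have "fst (last \<delta>) = l" using step by (simp add: v is_step_def)
  then have last_eq: "last \<delta> = (l, int k)"
    using strip last by (simp add: k_def prod_eq_iff)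
  moreover have "k < n" using strip last last_eq by auto
  ultimately show "\<gamma> \<in> ?B"
    using step path hd strip by (auto simp: \<gamma> v is_step_def bounded_paths_def)
next
  fix \<gamma> assume "\<gamma> \<in> ?B"
  then obtain k \<delta> where k: "- int p \<le> int j - int k" "int j - int k \<le> int q"
    and \<gamma>: "\<gamma> = \<delta> @ [(Suc l, int j)]" and d: "\<delta> \<in> bounded_paths p q l i k n"
    by auto
  have "\<delta> \<noteq> []" using d by (auto simp: bounded_paths_def lattice_path_def)
  then show "\<gamma> \<in> ?A" using d k assms
    by (auto simp: \<gamma> bounded_paths_def lattice_path_snoc is_step_def)
qed

lemma bounded_path_sum_Suc:
  assumes j: "j < n"
  shows "bounded_path_sum p q a (Suc l) i j n =
    (\<Sum>k<n. bounded_path_sum p q a l i k n * H_mat p q a n $$ (k, j))"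
proof -
  let ?K = "{k. k < n \<and> - int p \<le> int j - int k \<and> int j - int k \<le> int q}"
  let ?ext = "\<lambda>\<gamma>. \<gamma> @ [(Suc l, int j)]"
  have "bounded_path_sum p q a (Suc l) i j n =
      (\<Sum>k\<in>?K. \<Sum>\<gamma>\<in>?ext ` bounded_paths p q l i k n. path_weight a \<gamma>)"
    unfolding bounded_path_sum_def bounded_paths_Suc[OF j]
    \<comment> \<open>The images for distinct k are disjoint, since the last vertex but one has
      height k.\<close>
    by (rule sum.UNION_disjoint) (simp_all add: finite_bounded_paths, auto simp: bounded_paths_def)
  also have "\<dots> = (\<Sum>k\<in>?K. bounded_path_sum p q a l i k n * H_mat p q a n $$ (k, j))"
  proof (rule sum.cong)
    fix k assume k: "k \<in> ?K"
    have "path_weight a (?ext \<gamma>) = path_weight a \<gamma> * H_mat p q a n $$ (k, j)"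
      if "\<gamma> \<in> bounded_paths p q l i k n" for \<gamma>
    proof -
      have "\<gamma> \<noteq> []" "last \<gamma> = (l, int k)"
        using that by (auto simp: bounded_paths_def lattice_path_def)
      \<comment> \<open>Rising or falling, a step takes its weight at the lower of its two heights,
        which is the index \<open>min k j\<close> of the matrix entry.\<close>
      then show ?thesis using k j
        by (auto simp: path_weight_snoc step_weight_def H_mat_def min_def)
    qed
    then show "(\<Sum>\<gamma>\<in>?ext ` bounded_paths p q l i k n. path_weight a \<gamma>) =
        bounded_path_sum p q a l i k n * H_mat p q a n $$ (k, j)"
      by (simp add: sum.reindex inj_on_def bounded_path_sum_def sum_distrib_right)
  qed simp
  \<comment> \<open>Outside the band the matrix entries are 0, so k may run over all rows.\<close>
  also have "\<dots> = (\<Sum>k<n. bounded_path_sum p q a l i k n * H_mat p q a n $$ (k, j))"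
    by (rule sum.mono_neutral_left) (use j in \<open>auto simp: H_mat_def\<close>)
  finally show ?thesis .
qed

text \<open>Both sides obey the same recursion in l. It involves every end height k, so j stays
  arbitrary in the induction.\<close>

lemma H_mat_pow_eq_bounded_path_sum:
  assumes "i < n" "j < n"
  shows "(H_mat p q a n ^\<^sub>m l) $$ (i, j) = bounded_path_sum p q a l i j n"
  using assms(2)
proof (induction l arbitrary: j)
  case 0
  then show ?case using assms(1)
    by (simp add: bounded_path_sum_def bounded_paths_0 path_weight_def H_mat_def)
next
  case (Suc l)
  have H: "H_mat p q a n \<in> carrier_mat n n" by (simp add: H_mat_def)
  have "(H_mat p q a n ^\<^sub>m Suc l) $$ (i, j) =
      (\<Sum>k<n. (H_mat p q a n ^\<^sub>m l) $$ (i, k) * H_mat p q a n $$ (k, j))"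
    using Suc.prems assms(1) H pow_carrier_mat[OF H, of l]
    by (simp add: scalar_prod_def atLeast0LessThan)
  then show ?case using Suc by (simp add: bounded_path_sum_Suc)
qed

lemma bounded_paths_eq_paths:
  assumes "p \<ge> 1" "q \<ge> 1" "i < n" "j < n"
    and l: "l \<le> (n - 1 - i) div q + (n - 1 - j) div p + 1"
  shows "bounded_paths p q l i j n = paths p q l i j"
proof
  show "bounded_paths p q l i j n \<subseteq> paths p q l i j"
    by (auto simp: bounded_paths_def paths_def)
  show "paths p q l i j \<subseteq> bounded_paths p q l i j n"
  proof
    fix \<gamma> assume g: "\<gamma> \<in> paths p q l i j"
    then have path: "lattice_path p q l \<gamma>" and len: "length \<gamma> = Suc l"
      by (auto simp: paths_def lattice_path_def)
    then have ne: "\<gamma> \<noteq> []" by auto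
    have first: "\<gamma> ! 0 = (0, int i)" and last: "\<gamma> ! l = (l, int j)"
      using g ne len by (auto simp: paths_def hd_conv_nth last_conv_nth)
    have "snd v \<le> int n - 1" if v: "v \<in> set \<gamma>" for v
    proof (rule ccontr)
      assume high: "\<not> snd v \<le> int n - 1"
      from v obtain r where r: "r \<le> l" "v = \<gamma> ! r"
        using len by (auto simp: in_set_conv_nth less_Suc_eq_le)
      have "int n \<le> int i + int r * int q"
        using lattice_path_height_le(1)[OF path, of 0 r] first r high by simp
      then have "n \<le> i + r * q" by (simp flip: of_nat_mult of_nat_add)
      \<comment> \<open>The bound says n - 1 - i < r * q, which for integers amounts to the strict
        inequality for the quotient.\<close>
      then have up: "(n - 1 - i) div q < r"
        using assms by (simp add: div_less_iff_less_mult)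
      have "int n \<le> int j + int (l - r) * int p"
        using lattice_path_height_le(2)[OF path, of r "l - r"] last r high by simp
      then have "n \<le> j + (l - r) * p" by (simp flip: of_nat_mult of_nat_add)
      then have "(n - 1 - j) div p < l - r"
        using assms by (simp add: div_less_iff_less_mult)
      \<comment> \<open>Two strict inequalities between naturals add up to l being at least the sum
        of the quotients plus 2, one more than allowed.\<close>
      with up l show False by simp
    qed
    with g show "\<gamma> \<in> bounded_paths p q l i j n"
      by (auto simp: paths_def bounded_paths_def)
  qed
qed

theorem theorem7p2:
  fixes p q n i j L :: nat and a :: "int \<Rightarrow> int \<Rightarrow> complex"
  assumes "p \<ge> 1" and "q \<ge> 1"
    and "n \<ge> 1" and "i \<le> n - 1" and "j \<le> n - 1"
    and "L = (n - 1 - i) div q + (n - 1 - j) div p + 1"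
  shows "(\<forall>l\<le>L. bounded_paths p q l i j n = paths p q l i j
               \<and> bounded_path_sum p q a l i j n = path_sum p q a l i j)
       \<and> (\<forall>m. m > - int L - 2 \<longrightarrow>
            z_coeff (path_series p q a i j - resolvent p q a i j n) m = 0)"
proof -
  have ij: "i < n" "j < n" using assms by auto
  have eq: "bounded_paths p q l i j n = paths p q l i j" if "l \<le> L" for l
    using bounded_paths_eq_paths[OF assms(1,2) ij] that assms(6) by simp
  then have sum_eq: "bounded_path_sum p q a l i j n = path_sum p q a l i j" if "l \<le> L" for l
    using that by (simp add: bounded_path_sum_def path_sum_def)
  have "z_coeff (path_series p q a i j - resolvent p q a i j n) m = 0"
    if m: "m > - int L - 2" for m
  proof -
    \<comment> \<open>The coefficient of z^m belongs to paths of length -m - 1, and m > -L - 2 makes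
      this at most L. For m nonnegative \<open>nat\<close> truncates to 0, but there both
      coefficients vanish.\<close>
    have "nat (- m - 1) \<le> L" using m by linarith
    moreover have "z_coeff (path_series p q a i j - resolvent p q a i j n) m =
        z_coeff (path_series p q a i j) m - z_coeff (resolvent p q a i j n) m"
      by (simp add: z_coeff_def)
    ultimately show ?thesis
      by (simp add: z_coeff_path_series z_coeff_resolvent[OF ij]
          H_mat_pow_eq_bounded_path_sum[OF ij] sum_eq)
  qed
  with eq sum_eq show ?thesis by blast
qed

end
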